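(* Let $p$ be an odd prime, $n\ge1$ an integer, and $F:\mathbb{F}_{p^n}\to\mathbb{F}_{p^n}$ a function. Then $F$ is planar if and only if $$\mathcal{L}_F(u,v)=(0,\ldots,0)\qquad\text{for every }u,v\in\mathbb{F}_{p^n}^*.$$
   Context: $\mathrm{Tr}_1^n$ is the absolute trace $\mathbb{F}_{p^n}\to\mathbb{F}_p$; $\mathbb{F}_{p^n}^*=\mathbb{F}_{p^n}\setminus\{0\}$. The derivative is $D_uF(x)=F(x+u)-F(x)$. $F$ is planar if $D_uF$ is a permutation of $\mathbb{F}_{p^n}$ for every $u\in\mathbb{F}_{p^n}^*$. The profile is $\mathcal{L}_F(u,v)=(L_F(u,v;j))_{j\in\mathbb{F}_p}$, where $L_F(u,v;j)=\#\{x\in\mathbb{F}_{p^n}:\mathrm{Tr}_1^n(vD_uF(x))=j\}-p^{n-1}$. *)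

theory Defs
  imports
    "HOL-Library.FuncSet"
    "HOL-Library.Cardinality"
    "HOL-Computational_Algebra.Computational_Algebra"
    "HOL-Number_Theory.Cong"
begin

text \<open>
  The field with \<open>p ^ n\<close> elements is any type of class \<open>finite_field\<close> with \<open>CARD('a) = p ^ n\<close>.
  \<open>F\<^sub>p\<close> is taken inside it, as its prime subfield; the lemmas at the end show that for such a
  type this subfield has \<open>p\<close> elements and contains all values of the trace.
\<close>

definition prime_subfield :: "'a::finite_field set" where
  "prime_subfield = range of_nat"

definition abs_trace :: "nat \<Rightarrow> nat \<Rightarrow> 'a::finite_field \<Rightarrow> 'a" where
  "abs_trace p n x = (\<Sum>i<n. x ^ (p ^ i))"

definition derivative :: "('a::finite_field \<Rightarrow> 'a) \<Rightarrow> 'a \<Rightarrow> 'a \<Rightarrow> 'a" where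
  "derivative F u x = F (x + u) - F x"

definition planar :: "('a::finite_field \<Rightarrow> 'a) \<Rightarrow> bool" where
  "planar F \<longleftrightarrow> (\<forall>u. u \<noteq> 0 \<longrightarrow> bij (derivative F u))"

definition profile_entry ::
    "nat \<Rightarrow> nat \<Rightarrow> ('a::finite_field \<Rightarrow> 'a) \<Rightarrow> 'a \<Rightarrow> 'a \<Rightarrow> 'a \<Rightarrow> int" where
  "profile_entry p n F u v j =
     int (card {x. abs_trace p n (v * derivative F u x) = j}) - int (p ^ (n - 1))"

text \<open>A vector indexed by \<open>F\<^sub>p\<close> is a function that is \<open>undefined\<close> outside the prime subfield.\<close>

definition profile ::
    "nat \<Rightarrow> nat \<Rightarrow> ('a::finite_field \<Rightarrow> 'a) \<Rightarrow> 'a \<Rightarrow> 'a \<Rightarrow> ('a \<Rightarrow> int)" where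
  "profile p n F u v = (\<lambda>j\<in>prime_subfield. profile_entry p n F u v j)"

lemma CHAR_eq_if_card:
  assumes "prime p" "card (UNIV :: 'a::finite_field set) = p ^ n"
  shows "CHAR('a) = p"
proof -
  have "CHAR('a) dvd p ^ n"
  proof -
    have "(\<Sum>x\<in>UNIV. x + 1 :: 'a) = (\<Sum>x\<in>UNIV. x)"
      by (rule sum.reindex_bij_witness[of _ "\<lambda>x. x - 1" "\<lambda>x. x + 1"]) auto
    then have "(of_nat (card (UNIV :: 'a set)) :: 'a) = 0"
      by (simp add: sum.distrib)
    then show ?thesis
      using assms(2) of_nat_eq_0_iff_char_dvd by metis
  qed
  then have "CHAR('a) dvd p"
    using CHAR_prime[where 'a = 'a] prime_dvd_power by blast
  then show ?thesis
    using assms(1) CHAR_prime[where 'a = 'a] primes_dvd_imp_eq by blast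
qed

lemma card_prime_subfield: "card (prime_subfield :: 'a::finite_field set) = CHAR('a)"
proof -
  have eq: "(of_nat m :: 'a) = of_nat k \<longleftrightarrow> [m = k] (mod CHAR('a))" for m k
    by (rule of_nat_eq_iff_cong_CHAR)
  have "(prime_subfield :: 'a set) = of_nat ` {..<CHAR('a)}"
  proof -
    have "(of_nat m :: 'a) \<in> of_nat ` {..<CHAR('a)}" for m
      by (rule image_eqI[of _ _ "m mod CHAR('a)"]) (auto simp: eq cong_def)
    then show ?thesis
      unfolding prime_subfield_def by auto
  qed
  moreover have "inj_on (of_nat :: nat \<Rightarrow> 'a) {..<CHAR('a)}"
    by (auto simp: inj_on_def eq cong_def)
  ultimately show ?thesis
    by (metis card_image card_lessThan)
qed

lemma prime_subfield_iff: "(y::'a::finite_field) \<in> prime_subfield \<longleftrightarrow> y ^ CHAR('a) = y"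
proof -
  let ?p = "CHAR('a)"
  define q :: "'a poly" where "q = monom 1 ?p - monom 1 1"
  have p1: "?p > 1"
    using CHAR_prime[where 'a = 'a] prime_gt_1_nat by blast
  have "coeff q ?p = 1"
    using p1 by (simp add: q_def)
  then have q0: "q \<noteq> 0" by auto
  have deg: "degree q \<le> ?p"
    unfolding q_def using p1 by (intro degree_diff_le) (auto simp: degree_monom_eq)
  have roots: "{y. poly q y = 0} = {y::'a. y ^ ?p = y}"
    by (auto simp: q_def poly_monom)
  have fer: "(of_nat m :: 'a) ^ ?p = of_nat m" for m
  proof (induction m)
    case 0
    show ?case using p1 by simp
  next
    case (Suc m)
    have "(1 + of_nat m :: 'a) ^ ?p = 1 ^ ?p + of_nat m ^ ?p"
      by (rule freshmans_dream) auto
    then show ?case using Suc by simp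
  qed
  then have sub: "prime_subfield \<subseteq> {y::'a. y ^ ?p = y}"
    by (auto simp: prime_subfield_def)
  have "card {y::'a. y ^ ?p = y} \<le> ?p"
    using card_poly_roots_bound[OF q0] deg roots by simp
  then have "prime_subfield = {y::'a. y ^ ?p = y}"
    using sub card_prime_subfield[where 'a = 'a] by (intro card_seteq) auto
  then show ?thesis by blast
qed

lemma abs_trace_in_prime_subfield:
  assumes "prime p" "card (UNIV :: 'a::finite_field set) = p ^ n"
  shows "abs_trace p n (x::'a) \<in> prime_subfield"
proof -
  have p: "CHAR('a) = p" by (rule CHAR_eq_if_card[OF assms])
  have "abs_trace p n x ^ p = (\<Sum>i<n. (x ^ (p ^ i)) ^ p)"
    unfolding abs_trace_def using assms(1) p by (intro freshmans_dream_sum) auto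
  also have "\<dots> = (\<Sum>i<n. x ^ (p ^ Suc i))"
    by (simp add: power_mult [symmetric] mult.commute)
  also have "\<dots> = abs_trace p n x + x ^ (p ^ n) - x"
    unfolding abs_trace_def
    using sum.lessThan_Suc[of "\<lambda>i. x ^ (p ^ i)" n]
          sum.lessThan_Suc_shift[of "\<lambda>i. x ^ (p ^ i)" n] by simp
  also have "x ^ (p ^ n) = x"
    using finite_field_power_card_eq_same[of x] assms by simp
  finally show ?thesis
    by (simp add: prime_subfield_iff p)
qed

end

theory Submission
  imports Defs
begin

text \<open>
  A map \<open>G\<close> on a field with \<open>q = p ^ n\<close> elements is bijective iff \<open>Tr (v * G x)\<close> is balanced for
  every nonzero \<open>v\<close>. Trace fibres have \<open>p ^ (n - 1)\<close> elements, which gives one direction. For the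
  other, suppose that \<open>G\<close> misses \<open>y\<close> and count the pairs \<open>(v, x)\<close> with \<open>Tr (v * (G x - y)) = 0\<close>:
  there are \<open>q + (q - 1) * p ^ (n - 1)\<close> of them by the fibres over \<open>v\<close>, but \<open>q * p ^ (n - 1)\<close> by the
  fibres over \<open>x\<close>.
\<close>

lemma abs_trace_0:
  assumes "prime p"
  shows "abs_trace p n (0::'a::finite_field) = 0"
  using prime_gt_0_nat[OF assms] by (simp add: abs_trace_def power_0_left)

lemma abs_trace_add:
  assumes "CHAR('a) = p" "prime p"
  shows "abs_trace p n (x + y :: 'a::finite_field) = abs_trace p n x + abs_trace p n y"
  using assms by (simp add: abs_trace_def sum.distrib freshmans_dream')

lemma abs_trace_diff:
  assumes "CHAR('a) = p" "prime p"
  shows "abs_trace p n (x - y :: 'a::finite_field) = abs_trace p n x - abs_trace p n y"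
  using abs_trace_add[OF assms, of n "x - y" y] by simp

text \<open>The fibre over \<open>j\<close> is the root set of a nonzero polynomial of degree at
  most \<open>p ^ (n - 1)\<close>.\<close>

lemma card_abs_trace_fibre_le:
  assumes "prime p" "n \<ge> 1"
  shows "card {x::'a::finite_field. abs_trace p n x = j} \<le> p ^ (n - 1)"
proof -
  define f :: "'a poly" where "f = (\<Sum>i<n. monom 1 (p ^ i)) - [:j:]"
  have p1: "p > 1" using assms(1) prime_gt_1_nat by blast
  \<comment> \<open>Since \<open>p > 1\<close>, the exponents \<open>p ^ i\<close> are distinct and
    positive, so neither another monomial nor the constant \<open>j\<close> affects this
    coefficient.\<close>
  have "coeff f (p ^ (n - 1)) = (\<Sum>i<n. if i = n - 1 then 1 else 0)"
    using p1 by (simp add: f_def coeff_sum coeff_pCons split: nat.split)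
  also have "\<dots> = 1" using assms(2) by simp
  finally have f0: "f \<noteq> 0" by auto
  have "degree (monom (1::'a) (p ^ i)) \<le> p ^ (n - 1)" if "i < n" for i
    using p1 that by (simp add: degree_monom_eq)
  then have deg: "degree f \<le> p ^ (n - 1)"
    unfolding f_def by (intro degree_diff_le degree_sum_le) auto
  have "{x. abs_trace p n x = j} = {x. poly f x = 0}"
    by (simp add: f_def abs_trace_def poly_sum poly_monom)
  then show ?thesis
    using card_poly_roots_bound[OF f0] deg by simp
qed

text \<open>The \<open>p\<close> fibres over the prime subfield cover all \<open>p ^ n\<close>
  elements, and each has at most \<open>p ^ (n - 1)\<close>, so a single smaller fibre would make
  the total too small.\<close>

lemma card_abs_trace_fibre:
  assumes "prime p" "n \<ge> 1" "CARD('a::finite_field) = p ^ n" "(j::'a) \<in> prime_subfield"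
  shows "card {x::'a. abs_trace p n x = j} = p ^ (n - 1)"
proof (rule ccontr)
  let ?N = "\<lambda>k. card {x::'a. abs_trace p n x = k}"
  assume "?N j \<noteq> p ^ (n - 1)"
  then have "?N j < p ^ (n - 1)"
    using card_abs_trace_fibre_le[OF assms(1,2), of j] by simp
  then have "(\<Sum>k\<in>prime_subfield. ?N k) < (\<Sum>k\<in>(prime_subfield :: 'a set). p ^ (n - 1))"
    using assms(4) card_abs_trace_fibre_le[OF assms(1,2)]
    by (intro sum_strict_mono_ex1) auto
  also have "\<dots> = p ^ n"
    using CHAR_eq_if_card[OF assms(1,3)] assms(2)
    by (simp add: card_prime_subfield power_eq_if)
  also have "\<dots> = card (\<Union>k\<in>(prime_subfield :: 'a set). {x::'a. abs_trace p n x = k})"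
  proof -
    have "(\<Union>k\<in>(prime_subfield :: 'a set). {x::'a. abs_trace p n x = k}) = UNIV"
      using abs_trace_in_prime_subfield[OF assms(1,3)] by auto
    then show ?thesis using assms(3) by simp
  qed
  also have "\<dots> = (\<Sum>k\<in>prime_subfield. ?N k)"
    by (intro card_UN_disjoint) auto
  finally show False by simp
qed

text \<open>Multiplication by \<open>v\<close> is a permutation, so the set is the preimage of a
  trace fibre under a bijection.\<close>

lemma card_abs_trace_mult_fibre:
  assumes "prime p" "n \<ge> 1" "CARD('a::finite_field) = p ^ n" "(j::'a) \<in> prime_subfield"
    and "(v::'a) \<noteq> 0" "bij G"
  shows "card {x::'a. abs_trace p n (v * G x) = j} = p ^ (n - 1)"
proof -
  have "bij (\<lambda>y. v * y)"
    using assms(5) by (intro bij_betw_byWitness[where f' = "\<lambda>y. y / v"]) auto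
  then have b: "bij (\<lambda>x. v * G x)"
    using bij_comp[OF assms(6)] by (simp add: comp_def)
  have "card {x. abs_trace p n (v * G x) = j} = card ((\<lambda>x. v * G x) -` {y. abs_trace p n y = j})"
    by simp
  also have "\<dots> = card {y. abs_trace p n y = j}"
    using b by (intro card_vimage_inj) (auto simp: bij_def)
  finally show ?thesis
    using card_abs_trace_fibre[OF assms(1-4)] by simp
qed

lemma bij_if_abs_trace_balanced:
  fixes G :: "'a::finite_field \<Rightarrow> 'a"
  assumes p: "prime p" and n: "n \<ge> 1" and card: "CARD('a) = p ^ n"
    and balanced: "\<And>v j. v \<noteq> 0 \<Longrightarrow> j \<in> prime_subfield \<Longrightarrow>
      card {x. abs_trace p n (v * G x) = j} = p ^ (n - 1)"
  shows "bij G"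
proof -
  have char: "CHAR('a) = p" by (rule CHAR_eq_if_card[OF p card])
  have p1: "p > 1" using p prime_gt_1_nat by blast
  have "y \<in> range G" for y
  proof (rule ccontr)
    assume y: "y \<notin> range G"
    let ?P = "\<lambda>v x. abs_trace p n (v * (G x - y)) = 0"
    \<comment> \<open>By additivity, subtracting \<open>y\<close> only moves the target value from 0
      to the trace of \<open>v * y\<close>, again in the prime subfield.\<close>
    have "card {x. ?P v x} = p ^ (n - 1)" if "v \<noteq> 0" for v
    proof -
      have "{x. ?P v x} = {x. abs_trace p n (v * G x) = abs_trace p n (v * y)}"
        by (simp add: right_diff_distrib abs_trace_diff[OF char p])
      then show ?thesis
        using balanced[OF that abs_trace_in_prime_subfield[OF p card]] by simp
    qed
    \<comment> \<open>The term \<open>v = 0\<close> is split off: there every \<open>x\<close>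
      satisfies the condition.\<close>
    then have "(\<Sum>v\<in>UNIV. card {x. ?P v x}) = p ^ n + (\<Sum>v\<in>UNIV - {0::'a}. p ^ (n - 1))"
      by (subst sum.remove[of _ 0]) (auto simp: abs_trace_0[OF p] card)
    \<comment> \<open>Here the missed value matters: \<open>G x - y\<close> is never 0, so it serves
      as the nonzero multiplier, with the identity as bijection.\<close>
    moreover have "card {v. ?P v x} = p ^ (n - 1)" for x
    proof -
      have "0 \<in> (prime_subfield :: 'a set)"
        unfolding prime_subfield_def by (metis of_nat_0 rangeI)
      moreover have "G x - y \<noteq> 0" using y by auto
      ultimately show ?thesis
        using card_abs_trace_mult_fibre[OF p n card, of 0 "G x - y" "\<lambda>v. v"] bij_id
        by (simp add: mult.commute id_def)
    qed
    then have "(\<Sum>x\<in>UNIV. card {v. ?P v x}) = p ^ n * p ^ (n - 1)"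
      by (simp add: card)
    moreover have "(\<Sum>v\<in>UNIV. card {x. ?P v x}) = (\<Sum>x\<in>UNIV. card {v. ?P v x})"
      using sum.swap_restrict[of UNIV UNIV "\<lambda>_ _. 1::nat" ?P] by simp
    ultimately have "p ^ n + (p ^ n - 1) * p ^ (n - 1) = p ^ n * p ^ (n - 1)"
      by (simp add: card card_Diff_singleton)
    \<comment> \<open>Subtraction on \<open>nat\<close> truncates; adding \<open>p ^ (n - 1)\<close>
      back makes the two counts comparable by linear arithmetic.\<close>
    moreover have "(p ^ n - 1) * p ^ (n - 1) + p ^ (n - 1) = p ^ n * p ^ (n - 1)"
      using p1 by (cases "p ^ n") simp_all
    ultimately have "p ^ n = p ^ (n - 1)" by linarith
    then show False using p1 n by simp
  qed
  then have "surj G" by blast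
  then show ?thesis
    by (simp add: bij_def finite_UNIV_surj_inj)
qed

theorem corollary4p6:
  fixes p n :: nat and F :: "'a::finite_field \<Rightarrow> 'a"
  assumes "prime p" and "odd p" and "n \<ge> 1" and "CARD('a) = p ^ n"
  shows "planar F \<longleftrightarrow>
    (\<forall>u v. u \<noteq> 0 \<and> v \<noteq> 0 \<longrightarrow> profile p n F u v = (\<lambda>j\<in>prime_subfield. 0))"
proof -
  have "profile p n F u v = (\<lambda>j\<in>prime_subfield. 0) \<longleftrightarrow>
      (\<forall>j\<in>prime_subfield. card {x. abs_trace p n (v * derivative F u x) = j} = p ^ (n - 1))"
    for u v
  proof -
    \<comment> \<open>Both functions are \<open>undefined\<close> off the prime subfield, so only
      the entries indexed by it are compared.\<close>
    have "profile p n F u v = (\<lambda>j\<in>prime_subfield. 0) \<longleftrightarrow>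
        (\<forall>j\<in>prime_subfield. profile_entry p n F u v j = 0)"
      unfolding profile_def restrict_def by (auto simp: fun_eq_iff)
    then show ?thesis
      by (simp add: profile_entry_def flip: of_nat_power)
  qed
  then show ?thesis
    unfolding planar_def
    using bij_if_abs_trace_balanced[OF assms(1,3,4)] card_abs_trace_mult_fibre[OF assms(1,3,4)]
    by meson
qed

end
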